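(* Each positive Lebesgue operator $T$ from a vector lattice $X$ to a locally solid lattice $(Y,\tau)$ is quasi Lebesgue.
   Context: All vector spaces are real, operators are linear, vector topologies are Hausdorff, vector lattices are Archimedean. A locally solid lattice is a vector lattice with a linear topology having a base at zero of solid sets. An operator $T$ from a vector lattice $X$ to a topological vector space $(Y,\tau)$ is called Lebesgue if $Tx_\alpha\to0$ in $\tau$ for every net $(x_\alpha)$ in $X$ with $x_\alpha\downarrow 0$ (decreasing with infimum $0$); it is called quasi Lebesgue if $(Tx_\alpha)$ is $\tau$-Cauchy for every increasing net $(x_\alpha)$ in $X_+$ that is bounded above by some $x\in X$. *)

theory Defs
  imports "HOL-Analysis.Analysis" "HOL-Library.Lattice_Algebras" "HOL-Library.Lub_Glb"
begin

text \<open>The parent class \<^class>\<open>lattice_ab_group_add_abs\<close> supplies the modulus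
  \<open>\<bar>x\<bar> = sup x (- x)\<close>.\<close>

class vector_lattice = ordered_real_vector + lattice_ab_group_add_abs +
  assumes archimedean: "(\<And>n::nat. real n *\<^sub>R x \<le> y) \<Longrightarrow> x \<le> 0"

definition solid :: "'a::vector_lattice set \<Rightarrow> bool"
  where "solid S \<longleftrightarrow> (\<forall>x y. y \<in> S \<and> \<bar>x\<bar> \<le> \<bar>y\<bar> \<longrightarrow> x \<in> S)"

text \<open>The members of a base at zero are neighbourhoods of zero, not necessarily open sets.\<close>

class locally_solid_lattice = vector_lattice + topological_group_add + t2_space +
  assumes tendsto_scaleR_Pair:
      "filterlim (\<lambda>p. fst p *\<^sub>R snd p) (nhds (c *\<^sub>R y)) (nhds c \<times>\<^sub>F nhds y)"
    and solid_base:
      "open U \<Longrightarrow> 0 \<in> U \<Longrightarrow>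
        \<exists>S. S \<subseteq> U \<and> (\<forall>x y. y \<in> S \<and> \<bar>x\<bar> \<le> \<bar>y\<bar> \<longrightarrow> x \<in> S) \<and> (\<exists>V. open V \<and> 0 \<in> V \<and> V \<subseteq> S)"

lemma locally_solid_base:
  fixes U :: "'b::locally_solid_lattice set"
  assumes "open U" "0 \<in> U"
  shows "\<exists>S \<subseteq> U. solid S \<and> eventually (\<lambda>x. x \<in> S) (nhds 0)"
  using solid_base[OF assms] unfolding solid_def eventually_nhds by blast

text \<open>A net is a function on a nonempty set \<open>A\<close> of indices, directed upwards by a preorder
  \<open>le\<close> that need not be antisymmetric.\<close>

definition directed_set :: "'i set \<Rightarrow> ('i \<Rightarrow> 'i \<Rightarrow> bool) \<Rightarrow> bool"
  where "directed_set A le \<longleftrightarrow> A \<noteq> {} \<and> reflp_on A le \<and> transp_on A le \<and>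
    (\<forall>i\<in>A. \<forall>j\<in>A. \<exists>k\<in>A. le i k \<and> le j k)"

definition net_filter :: "'i set \<Rightarrow> ('i \<Rightarrow> 'i \<Rightarrow> bool) \<Rightarrow> 'i filter"
  where "net_filter A le = (INF i\<in>A. principal {j \<in> A. le i j})"

lemma eventually_net_filter:
  assumes "directed_set A le"
  shows "eventually P (net_filter A le) \<longleftrightarrow> (\<exists>i\<in>A. \<forall>j\<in>A. le i j \<longrightarrow> P j)"
proof -
  have "eventually P (net_filter A le) \<longleftrightarrow>
      (\<exists>i\<in>A. eventually P (principal {j \<in> A. le i j}))"
    unfolding net_filter_def
  proof (rule eventually_INF_base)
    show "A \<noteq> {}" using assms by (simp add: directed_set_def)
  next
    fix i j assume ij: "i \<in> A" "j \<in> A"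
    then obtain k where k: "k \<in> A" "le i k" "le j k"
      using assms unfolding directed_set_def by blast
    have "{l \<in> A. le k l} \<subseteq> {l \<in> A. le i l} \<inter> {l \<in> A. le j l}"
      using assms ij k unfolding directed_set_def by (auto dest: transp_onD)
    then show "\<exists>k\<in>A. principal {l \<in> A. le k l} \<le>
        inf (principal {l \<in> A. le i l}) (principal {l \<in> A. le j l})"
      using k(1) by auto
  qed
  then show ?thesis by (auto simp: eventually_principal)
qed

definition decreasing_to_zero ::
    "'i set \<Rightarrow> ('i \<Rightarrow> 'i \<Rightarrow> bool) \<Rightarrow> ('i \<Rightarrow> 'a::vector_lattice) \<Rightarrow> bool"
  where "decreasing_to_zero A le x \<longleftrightarrow> monotone_on A le (\<ge>) x \<and> isGlb UNIV (x ` A) 0"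

definition cauchy_net ::
    "'i set \<Rightarrow> ('i \<Rightarrow> 'i \<Rightarrow> bool) \<Rightarrow> ('i \<Rightarrow> 'b::locally_solid_lattice) \<Rightarrow> bool"
  where "cauchy_net A le y \<longleftrightarrow>
    (\<forall>U. open U \<longrightarrow> 0 \<in> U \<longrightarrow>
      (\<exists>k\<in>A. \<forall>i\<in>A. \<forall>j\<in>A. le k i \<longrightarrow> le k j \<longrightarrow> y i - y j \<in> U))"

definition positive_operator :: "('a::vector_lattice \<Rightarrow> 'b::vector_lattice) \<Rightarrow> bool"
  where "positive_operator T \<longleftrightarrow> linear T \<and> (\<forall>x\<ge>0. 0 \<le> T x)"

text \<open>A definition in HOL cannot quantify over the type \<^typ>\<open>'i\<close> of indices, so the next two
  notions take it as a parameter. For the Lebesgue property, nets indexed by subsets of the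
  domain decide the matter for all nets: see \<open>lebesgue_operator_index\<close> below.\<close>

definition lebesgue_operator ::
    "'i itself \<Rightarrow> ('a::vector_lattice \<Rightarrow> 'b::locally_solid_lattice) \<Rightarrow> bool"
  where "lebesgue_operator _ T \<longleftrightarrow>
    (\<forall>(A :: 'i set) le x. directed_set A le \<and> decreasing_to_zero A le x \<longrightarrow>
      ((\<lambda>i. T (x i)) \<longlongrightarrow> 0) (net_filter A le))"

definition quasi_lebesgue_operator ::
    "'i itself \<Rightarrow> ('a::vector_lattice \<Rightarrow> 'b::locally_solid_lattice) \<Rightarrow> bool"
  where "quasi_lebesgue_operator _ T \<longleftrightarrow>
    (\<forall>(A :: 'i set) le x.
      directed_set A le \<and> monotone_on A le (\<le>) x \<and> (\<forall>i\<in>A. 0 \<le> x i) \<and>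
      (\<exists>u. \<forall>i\<in>A. x i \<le> u) \<longrightarrow>
      cauchy_net A le (\<lambda>i. T (x i)))"

lemma lebesgue_operator_index:
  fixes T :: "'a::vector_lattice \<Rightarrow> 'b::locally_solid_lattice"
  assumes "lebesgue_operator TYPE('a) T"
  shows "lebesgue_operator TYPE('i) T"
  unfolding lebesgue_operator_def
proof (intro allI impI)
  fix A :: "'i set" and le and x :: "'i \<Rightarrow> 'a"
  assume *: "directed_set A le \<and> decreasing_to_zero A le x"
  then have dir: "directed_set A le" and mono: "monotone_on A le (\<ge>) x"
    and glb: "isGlb UNIV (x ` A) 0"
    by (auto simp: decreasing_to_zero_def)
  have "directed_set (x ` A) (\<ge>)"
    unfolding directed_set_def
  proof (intro conjI ballI)
    show "x ` A \<noteq> {}" using dir by (simp add: directed_set_def)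
    show "reflp_on (x ` A) (\<ge>)" "transp_on (x ` A) (\<ge>)"
      by (auto intro!: reflp_onI transp_onI)
    fix a b assume "a \<in> x ` A" "b \<in> x ` A"
    then obtain i j where ij: "i \<in> A" "j \<in> A" "a = x i" "b = x j" by auto
    then obtain k where "k \<in> A" "le i k" "le j k"
      using dir unfolding directed_set_def by blast
    then show "\<exists>k\<in>x ` A. a \<ge> k \<and> b \<ge> k"
      using ij mono unfolding monotone_on_def by blast
  qed
  moreover from this glb have "decreasing_to_zero (x ` A) (\<ge>) (\<lambda>a. a)"
    by (simp add: decreasing_to_zero_def monotone_on_def)
  ultimately have lim: "((\<lambda>a. T a) \<longlongrightarrow> 0) (net_filter (x ` A) (\<ge>))"
    and dir': "directed_set (x ` A) (\<ge>)"
    using assms unfolding lebesgue_operator_def by blast+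
  show "((\<lambda>i. T (x i)) \<longlongrightarrow> 0) (net_filter A le)"
    unfolding tendsto_def
  proof (intro allI impI)
    fix U :: "'b set" assume "open U" "0 \<in> U"
    then have "eventually (\<lambda>a. T a \<in> U) (net_filter (x ` A) (\<ge>))"
      using lim by (simp add: tendsto_def)
    then obtain i where "i \<in> A" "\<forall>j\<in>A. x j \<le> x i \<longrightarrow> T (x j) \<in> U"
      unfolding eventually_net_filter[OF dir'] by auto
    then show "eventually (\<lambda>i. T (x i) \<in> U) (net_filter A le)"
      unfolding eventually_net_filter[OF dir]
      using mono unfolding monotone_on_def by blast
  qed
qed

end

theory Submission
  imports Defs
begin

text \<open>Let \<open>x\<close> be an increasing net, bounded above, with range \<open>B\<close>. \<open>B\<close> need not have a
  supremum that the net could be compared with, but the gaps \<open>u - b\<close> between upper bounds \<open>u\<close> and elements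
  \<open>b\<close> of \<open>B\<close> serve in its place: they are directed downwards, and the Archimedean property makes
  their infimum \<open>0\<close> (\<open>isGlb_upper_gaps\<close>). The Lebesgue property, applied to the gaps as a net
  indexed by itself, yields a gap \<open>u - x\<^sub>k\<close> whose image under \<open>T\<close> lies in a prescribed solid
  neighbourhood of \<open>0\<close>. For every \<open>i\<close> beyond \<open>k\<close> we have \<open>0 \<le> x\<^sub>i - x\<^sub>k \<le> u - x\<^sub>k\<close>, so positivity
  and solidity put \<open>T x\<^sub>i - T x\<^sub>k\<close> into that neighbourhood too. Hence the tail of \<open>T x\<close> beyond \<open>k\<close>
  stays close to \<open>T x\<^sub>k\<close>, which is the Cauchy property.\<close>

definition upper_gaps :: "'a::vector_lattice set \<Rightarrow> 'a set"
  where "upper_gaps B = {u - b |u b. b \<in> B \<and> (\<forall>c\<in>B. c \<le> u)}"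

text \<open>A lower bound \<open>w\<close> of the gaps can be subtracted from any upper bound of \<open>B\<close>, and the result
  is again an upper bound. Iterating this, all multiples of \<open>w\<close> stay below one fixed gap, which the
  Archimedean property allows only for \<open>w \<le> 0\<close>.\<close>

lemma lower_bound_upper_gaps_nonpos:
  fixes B :: "'a::vector_lattice set"
  assumes b: "b \<in> B" and u: "\<forall>c\<in>B. c \<le> u"
    and w: "\<And>d. d \<in> upper_gaps B \<Longrightarrow> w \<le> d"
  shows "w \<le> 0"
proof (rule archimedean)
  fix n :: nat
  have "\<forall>c\<in>B. c \<le> u - real n *\<^sub>R w"
  proof (induction n)
    case 0
    show ?case using u by simp
  next
    case (Suc n)
    show ?case
    proof
      fix c assume "c \<in> B"
      with Suc have "(u - real n *\<^sub>R w) - c \<in> upper_gaps B"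
        unfolding upper_gaps_def by blast
      then have "w \<le> (u - real n *\<^sub>R w) - c" by (rule w)
      then show "c \<le> u - real (Suc n) *\<^sub>R w"
        by (simp add: algebra_simps)
    qed
  qed
  with b have "b \<le> u - real n *\<^sub>R w" by blast
  then show "real n *\<^sub>R w \<le> u - b" by (simp add: algebra_simps)
qed

lemma isGlb_upper_gaps:
  fixes B :: "'a::vector_lattice set"
  assumes "b \<in> B" "\<forall>c\<in>B. c \<le> u"
  shows "isGlb UNIV (upper_gaps B) 0"
proof (rule isGlbI2)
  show "isLb UNIV (upper_gaps B) 0"
    by (auto simp: isLb_def setge_def upper_gaps_def)
  show "Collect (isLb UNIV (upper_gaps B)) *<= 0"
    using lower_bound_upper_gaps_nonpos[OF assms]
    by (auto simp: isLb_def setge_def setle_def)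
qed

lemma directed_upper_gaps:
  fixes B :: "'a::vector_lattice set"
  assumes ne: "b \<in> B" "\<forall>c\<in>B. c \<le> u"
    and dir: "\<And>a b. a \<in> B \<Longrightarrow> b \<in> B \<Longrightarrow> \<exists>c\<in>B. a \<le> c \<and> b \<le> c"
  shows "directed_set (upper_gaps B) (\<ge>)"
  unfolding directed_set_def
proof (intro conjI ballI)
  show "upper_gaps B \<noteq> {}" using ne unfolding upper_gaps_def by blast
  show "reflp_on (upper_gaps B) (\<ge>)" "transp_on (upper_gaps B) (\<ge>)"
    by (auto intro!: reflp_onI transp_onI)
  fix d e assume "d \<in> upper_gaps B" "e \<in> upper_gaps B"
  then obtain v a v' a' where va: "d = v - a" "a \<in> B" "\<forall>c\<in>B. c \<le> v"
    "e = v' - a'" "a' \<in> B" "\<forall>c\<in>B. c \<le> v'"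
    unfolding upper_gaps_def by blast
  then obtain c where c: "c \<in> B" "a \<le> c" "a' \<le> c" using dir by blast
  have "\<forall>c\<in>B. c \<le> inf v v'" using va(3,6) by simp
  with c(1) have "inf v v' - c \<in> upper_gaps B"
    unfolding upper_gaps_def by blast
  moreover have "inf v v' - c \<le> d" "inf v v' - c \<le> e"
    unfolding va(1,4) using c by (auto intro!: diff_mono)
  ultimately show "\<exists>k\<in>upper_gaps B. d \<ge> k \<and> e \<ge> k" by blast
qed

lemma nhds_zero_diff:
  fixes U :: "'b::topological_group_add set"
  assumes "open U" "0 \<in> U"
  obtains V where "open V" "0 \<in> V" "\<And>a b. a \<in> V \<Longrightarrow> b \<in> V \<Longrightarrow> a - b \<in> U"
proof -
  have "((\<lambda>p. fst p - snd p) \<longlongrightarrow> 0 - (0::'b)) (nhds 0 \<times>\<^sub>F nhds 0)"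
    by (intro tendsto_diff filterlim_fst filterlim_snd)
  then have "eventually (\<lambda>p. fst p - snd p \<in> U) (nhds 0 \<times>\<^sub>F nhds (0::'b))"
    using assms by (simp add: tendsto_def)
  then show ?thesis
    using that unfolding eventually_prod_same eventually_nhds by fastforce
qed

lemma positive_operator_solid:
  assumes T: "positive_operator T" and S: "solid S"
    and "0 \<le> a" "a \<le> d" "T d \<in> S"
  shows "T a \<in> S"
proof -
  have lin: "linear T" using T by (simp add: positive_operator_def)
  have "0 \<le> T a" "0 \<le> T (d - a)"
    using T assms(3,4) by (simp_all add: positive_operator_def)
  then have "\<bar>T a\<bar> \<le> \<bar>T d\<bar>"
    by (simp add: linear_diff[OF lin])
  then show ?thesis using S \<open>T d \<in> S\<close> unfolding solid_def by blast
qed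

text \<open>The Lebesgue property for nets indexed by subsets of \<open>'a\<close> gives the Cauchy property for nets
  over any type \<open>'i\<close>, because the gaps, being elements of \<open>'a\<close>, can index themselves.\<close>

theorem theorem2p2:
  fixes T :: "'a::vector_lattice \<Rightarrow> 'b::locally_solid_lattice"
  assumes "positive_operator T"
    and "lebesgue_operator TYPE('a) T"
  shows "quasi_lebesgue_operator TYPE('i) T"
  unfolding quasi_lebesgue_operator_def cauchy_net_def
proof (intro allI impI)
  fix A :: "'i set" and le and x :: "'i \<Rightarrow> 'a" and U :: "'b set"
  assume *: "directed_set A le \<and> monotone_on A le (\<le>) x \<and> (\<forall>i\<in>A. 0 \<le> x i) \<and>
      (\<exists>u. \<forall>i\<in>A. x i \<le> u)"
    and U: "open U" "0 \<in> U"
  from * have dir: "directed_set A le" and mono: "monotone_on A le (\<le>) x"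
    by auto
  from * obtain u where u: "\<forall>c\<in>x ` A. c \<le> u" by auto
  from dir obtain b where b: "b \<in> x ` A" unfolding directed_set_def by blast
  have lin: "linear T" using assms(1) by (simp add: positive_operator_def)
  let ?G = "upper_gaps (x ` A)"

  obtain V where V: "open V" "0 \<in> V" "\<And>a b. a \<in> V \<Longrightarrow> b \<in> V \<Longrightarrow> a - b \<in> U"
    using nhds_zero_diff[OF U] by blast
  obtain S where S: "S \<subseteq> V" "solid S" "eventually (\<lambda>y. y \<in> S) (nhds 0)"
    using locally_solid_base[OF V(1,2)] by blast

  have "\<exists>c\<in>x ` A. a \<le> c \<and> a' \<le> c" if "a \<in> x ` A" "a' \<in> x ` A" for a a'
    using that dir mono unfolding directed_set_def monotone_on_def by blast
  then have dirG: "directed_set ?G (\<ge>)"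
    by (rule directed_upper_gaps[OF b u])
  have "decreasing_to_zero ?G (\<ge>) (\<lambda>d. d)"
    using isGlb_upper_gaps[OF b u] by (simp add: decreasing_to_zero_def monotone_on_def)
  with dirG assms(2) have "(T \<longlongrightarrow> 0) (net_filter ?G (\<ge>))"
    unfolding lebesgue_operator_def by blast
  then have "eventually (\<lambda>d. T d \<in> S) (net_filter ?G (\<ge>))"
    by (rule eventually_compose_filterlim[OF S(3)])
  then obtain d where d: "d \<in> ?G" "T d \<in> S"
    unfolding eventually_net_filter[OF dirG] by blast
  then obtain v k where k: "k \<in> A" "d = v - x k" and v: "\<forall>c\<in>x ` A. c \<le> v"
    unfolding upper_gaps_def by blast
  have tail: "T (x i) - T (x k) \<in> V" if "i \<in> A" "le k i" for i
  proof -
    have "0 \<le> x i - x k" using mono k(1) that by (simp add: monotone_on_def)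
    moreover have "x i - x k \<le> d" using v that(1) by (simp add: k(2))
    ultimately have "T (x i - x k) \<in> S"
      using positive_operator_solid[OF assms(1) S(2)] d(2) by blast
    then show ?thesis using S(1) by (auto simp: linear_diff[OF lin])
  qed
  have "T (x i) - T (x j) \<in> U" if "i \<in> A" "j \<in> A" "le k i" "le k j" for i j
    using V(3)[OF tail[OF that(1,3)] tail[OF that(2,4)]] by simp
  with k(1) show "\<exists>k\<in>A. \<forall>i\<in>A. \<forall>j\<in>A. le k i \<longrightarrow> le k j \<longrightarrow> T (x i) - T (x j) \<in> U"
    by blast
qed

end
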